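(* Let $a,b$ be integers with $2\le a\le b$. For every $(a,b)$-degenerate graph $G$, it holds that $$\chi_{\rm pcf}(G)\le \max\{5,\ \lfloor a/2\rfloor+2b-1\}.$$
   Context: All graphs are simple, finite and undirected. A vertex coloring of a graph is proper if adjacent vertices get distinct colors. It is conflict-free (with respect to open neighborhoods) if for every non-isolated vertex $x$ there is a color that appears exactly once on the open neighborhood $N(x)$. A PCF $k$-coloring is a vertex coloring with at most $k$ colors that is both proper and conflict-free. The PCF chromatic number $\chi_{\rm pcf}(G)$ is the minimum $k$ for which $G$ admits a PCF $k$-coloring. Given integers $a,b$ with $2\le a\le b$, a graph $G$ is $(a,b)$-degenerate if every induced subgraph $H$ of $G$ with at least one vertex (including $G$ itself) has the following property: there is a vertex $u$ of $H$ with $\deg_H(u)\le 1$, or there is an edge $vw$ of $H$ with $\deg_H(v)\le a$ and $\deg_H(w)\le b$. *)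

theory Defs
  imports "Graph_Theory.Digraph_Component"
begin

text \<open>
  A finite simple undirected graph is an instance of the locale \<^locale>\<open>graph\<close>: a finite
  symmetric digraph without loops or parallel arcs. An edge \<open>uv\<close> is thus the pair of
  opposite arcs from \<open>u\<close> to \<open>v\<close> and from \<open>v\<close> to \<open>u\<close>, and the degree of a vertex is its
  \<^const>\<open>out_degree\<close>.
\<close>

definition nbhd :: "('a, 'b) pre_digraph \<Rightarrow> 'a \<Rightarrow> 'a set" where
  "nbhd G x = {y. x \<rightarrow>\<^bsub>G\<^esub> y}"

definition proper_coloring :: "('a, 'b) pre_digraph \<Rightarrow> ('a \<Rightarrow> nat) \<Rightarrow> bool" where
  "proper_coloring G c \<longleftrightarrow> (\<forall>u v. u \<rightarrow>\<^bsub>G\<^esub> v \<longrightarrow> c u \<noteq> c v)"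

definition conflict_free_coloring :: "('a, 'b) pre_digraph \<Rightarrow> ('a \<Rightarrow> nat) \<Rightarrow> bool" where
  "conflict_free_coloring G c \<longleftrightarrow>
     (\<forall>x \<in> verts G. nbhd G x \<noteq> {} \<longrightarrow> (\<exists>col. card {y \<in> nbhd G x. c y = col} = 1))"

definition pcf_coloring :: "('a, 'b) pre_digraph \<Rightarrow> nat \<Rightarrow> ('a \<Rightarrow> nat) \<Rightarrow> bool" where
  "pcf_coloring G k c \<longleftrightarrow>
     card (c ` verts G) \<le> k \<and> proper_coloring G c \<and> conflict_free_coloring G c"

definition pcf_chromatic_number :: "('a, 'b) pre_digraph \<Rightarrow> nat" where
  "pcf_chromatic_number G = (LEAST k. \<exists>c. pcf_coloring G k c)"

text \<open>
  A coloring with pairwise distinct colors is PCF, so the minimum above is over a nonempty set.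
\<close>
lemma (in graph) ex_pcf_coloring: "\<exists>c. pcf_coloring G (card (verts G)) c"
proof -
  obtain c :: "'a \<Rightarrow> nat" where inj: "inj_on c (verts G)"
    using finite_imp_inj_to_nat_seg[OF finite_verts] by blast
  have adj: "u \<in> verts G \<and> v \<in> verts G \<and> u \<noteq> v" if "u \<rightarrow> v" for u v
    using that adj_not_same[of u] by (fastforce elim: reachableE)
  have "card {y \<in> nbhd G x. c y = c z} = 1" if "z \<in> nbhd G x" for x z
  proof -
    have "{y \<in> nbhd G x. c y = c z} = {z}"
      using that adj inj_onD[OF inj] unfolding nbhd_def by blast
    then show ?thesis by simp
  qed
  then have "conflict_free_coloring G c"
    unfolding conflict_free_coloring_def by blast
  moreover have "proper_coloring G c"
    using adj inj_onD[OF inj] unfolding proper_coloring_def by blast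
  ultimately show ?thesis
    unfolding pcf_coloring_def using card_image_le[OF finite_verts] by blast
qed

definition degenerate :: "nat \<Rightarrow> nat \<Rightarrow> ('a, 'b) pre_digraph \<Rightarrow> bool" where
  "degenerate a b G \<longleftrightarrow>
     (\<forall>H. induced_subgraph H G \<and> verts H \<noteq> {} \<longrightarrow>
        (\<exists>u \<in> verts H. out_degree H u \<le> 1) \<or>
        (\<exists>v w. v \<rightarrow>\<^bsub>H\<^esub> w \<and> out_degree H v \<le> a \<and> out_degree H w \<le> b))"

end

theory Submission
  imports Defs
begin

text \<open>
  Induct on the number of vertices. A vertex of degree at most 1 is easy to add back. Otherwise
  delete both ends of an edge \<open>vw\<close> with \<open>deg v \<le> a\<close> and \<open>deg w \<le> b\<close> and color the rest. Each
  remaining neighbor \<open>x\<close> of \<open>v\<close> forbids two colors at \<open>v\<close>: its own and one appearing exactly once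
  around \<open>x\<close>. The vertex \<open>v\<close> itself is conflict-free as soon as \<open>w\<close> avoids a set \<open>X v\<close> of colors:
  one color appearing once on \<open>A = N(v) - {w}\<close> if there is one, and otherwise all colors of \<open>A\<close>, of
  which there are at most \<open>|A| / 2\<close>. This leaves at least one color for each of \<open>v\<close> and \<open>w\<close>.
  If \<open>A\<close> has at least two vertices, all of distinct colors, then \<open>X v\<close> may be taken empty, which
  leaves \<open>w\<close> a second color; in all other cases \<open>v\<close> has a second color. So \<open>v\<close> and \<open>w\<close> can
  receive distinct colors.
\<close>

section \<open>Colorings of a relation restricted to a vertex set\<close>

text \<open>With a fixed relation \<open>E\<close>, an induced subgraph is just a subset
  \<open>S\<close>, so deleting and restoring vertices only changes a set.\<close>

definition nbrs_in :: "('a \<Rightarrow> 'a \<Rightarrow> bool) \<Rightarrow> 'a set \<Rightarrow> 'a \<Rightarrow> 'a set" where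
  "nbrs_in E S x = {y \<in> S. E x y}"

definition has_unique_color :: "('a \<Rightarrow> nat) \<Rightarrow> 'a set \<Rightarrow> bool" where
  "has_unique_color c A \<longleftrightarrow> (\<exists>z\<in>A. \<forall>y\<in>A. c y = c z \<longrightarrow> y = z)"

definition proper_on :: "('a \<Rightarrow> 'a \<Rightarrow> bool) \<Rightarrow> 'a set \<Rightarrow> ('a \<Rightarrow> nat) \<Rightarrow> bool" where
  "proper_on E S c \<longleftrightarrow> (\<forall>x\<in>S. \<forall>y\<in>S. E x y \<longrightarrow> c x \<noteq> c y)"

definition conflict_free_at :: "('a \<Rightarrow> 'a \<Rightarrow> bool) \<Rightarrow> 'a set \<Rightarrow> ('a \<Rightarrow> nat) \<Rightarrow> 'a \<Rightarrow> bool" where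
  "conflict_free_at E S c x \<longleftrightarrow> nbrs_in E S x \<noteq> {} \<longrightarrow> has_unique_color c (nbrs_in E S x)"

lemma finite_nbrs_in [simp]: "finite S \<Longrightarrow> finite (nbrs_in E S x)"
  by (simp add: nbrs_in_def)

lemma has_unique_color_iff_card:
  "has_unique_color c A \<longleftrightarrow> (\<exists>col. card {y \<in> A. c y = col} = 1)"
proof
  assume "has_unique_color c A"
  then obtain z where "z \<in> A" "\<And>y. y \<in> A \<Longrightarrow> c y = c z \<Longrightarrow> y = z"
    by (auto simp: has_unique_color_def)
  then have "{y \<in> A. c y = c z} = {z}" by auto
  then have "card {y \<in> A. c y = c z} = 1" by simp
  then show "\<exists>col. card {y \<in> A. c y = col} = 1" ..
next
  assume "\<exists>col. card {y \<in> A. c y = col} = 1"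
  then obtain col z where z: "{y \<in> A. c y = col} = {z}" by (auto simp: card_1_singleton_iff)
  then have "z \<in> A" "c z = col" by auto
  moreover have "y = z" if "y \<in> A" "c y = col" for y using that z by blast
  ultimately show "has_unique_color c A" unfolding has_unique_color_def by metis
qed

text \<open>Without a unique color, every color class on \<open>A\<close> has at least two elements,
  and the classes partition \<open>A\<close>.\<close>

lemma card_image_le_half:
  assumes "finite A" and "\<not> has_unique_color c A"
  shows "2 * card (c ` A) \<le> card A"
proof -
  have fib: "2 \<le> card {x \<in> A. c x = j}" if j: "j \<in> c ` A" for j
  proof -
    from j obtain z where z: "z \<in> A" "c z = j" by auto
    with assms(2) obtain y where y: "y \<in> A" "c y = c z" "y \<noteq> z"
      unfolding has_unique_color_def by metis
    have "card {y, z} \<le> card {x \<in> A. c x = j}"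
      using assms(1) y z by (intro card_mono) auto
    with y(3) show ?thesis by simp
  qed
  have "2 * card (c ` A) = (\<Sum>j\<in>c ` A. 2)" by simp
  also have "\<dots> \<le> (\<Sum>j\<in>c ` A. card {x \<in> A. c x = j})"
    by (intro sum_mono fib)
  also have "\<dots> = card A"
    using sum.image_gen[OF assms(1), of "\<lambda>_. 1::nat" c] by simp
  finally show ?thesis .
qed

text \<open>Here \<open>insert w A\<close> is the neighborhood of a vertex whose neighbors in
  \<open>A\<close> are already colored, and \<open>X\<close> restricts the color of the last
  neighbor \<open>w\<close>. The \<open>1\<close> in the bound pays for protecting a color already
  unique on \<open>A\<close>, the half for making the color of \<open>w\<close> itself
  unique.\<close>

lemma ex_avoid_set_has_unique_color_insert:
  assumes "finite A" and "w \<notin> A"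
  shows "\<exists>X. finite X \<and> card X \<le> max 1 (card A div 2) \<and> (inj_on c A \<and> 2 \<le> card A \<longrightarrow> X = {}) \<and>
    (\<forall>d. (\<forall>x\<in>A. d x = c x) \<and> d w \<notin> X \<longrightarrow> has_unique_color d (insert w A))"
proof -
  have new: "has_unique_color d (insert w A)" if "\<forall>x\<in>A. d x = c x" "d w \<notin> c ` A" for d
    unfolding has_unique_color_def
    using that by (intro bexI[of _ w]) (auto simp: image_iff)
  consider (inj) "inj_on c A" "2 \<le> card A"
    | (unique) "\<not> (inj_on c A \<and> 2 \<le> card A)" "has_unique_color c A"
    | (none) "\<not> (inj_on c A \<and> 2 \<le> card A)" "\<not> has_unique_color c A"
    by blast
  then show ?thesis
  proof cases
    case inj
    have "has_unique_color d (insert w A)" if d: "\<forall>x\<in>A. d x = c x" for d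
    \<comment> \<open>The color of \<open>w\<close> can coincide with that of at most one
      \<open>x\<close> in \<open>A\<close>; any other element of \<open>A\<close> keeps its unique
      color.\<close>
    proof (cases "d w \<in> c ` A")
      case True
      then obtain x where x: "x \<in> A" "d w = c x" by auto
      have "A \<noteq> {x}" using inj(2) by auto
      with x obtain z where z: "z \<in> A" "z \<noteq> x" by blast
      have "y = z" if "y \<in> insert w A" "d y = d z" for y
        using that x z d inj_onD[OF inj(1)] by (metis insertE)
      with z show ?thesis unfolding has_unique_color_def by blast
    qed (use new d in blast)
    then show ?thesis by (intro exI[of _ "{}"]) auto
  next
    case unique
    then obtain z where z: "z \<in> A" "\<And>y. y \<in> A \<Longrightarrow> c y = c z \<Longrightarrow> y = z"
      by (auto simp: has_unique_color_def)
    have "has_unique_color d (insert w A)" if "\<forall>x\<in>A. d x = c x" "d w \<noteq> c z" for d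
      unfolding has_unique_color_def
      using that z by (intro bexI[of _ z]) auto
    with unique(1) show ?thesis by (intro exI[of _ "{c z}"]) auto
  next
    case none
    have "card (c ` A) \<le> card A div 2"
      using card_image_le_half[OF assms(1) none(2)] by simp
    with none(1) assms(1) new show ?thesis by (intro exI[of _ "c ` A"]) auto
  qed
qed

text \<open>\<open>F\<close> depends only on the old coloring, so it serves for restoring one vertex
  as well as two. Equality in the bound on \<open>F v\<close> forces the neighbors of
  \<open>v\<close> to have distinct colors, because their own colors contribute at most the size of
  their image. Conflict-freeness at the restored vertices is left to the caller.\<close>

lemma ex_forbidden_colors:
  assumes E: "symp E" "irreflp E"
    and fin: "finite S" and proper: "proper_on E S c" and cf: "\<forall>x\<in>S. conflict_free_at E S c x"
  shows "\<exists>F. (\<forall>v. finite (F v) \<and> card (F v) \<le> 2 * card (nbrs_in E S v) \<and>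
      (card (F v) = 2 * card (nbrs_in E S v) \<longrightarrow> inj_on c (nbrs_in E S v))) \<and>
    (\<forall>T d. T \<inter> S = {} \<and> (\<forall>x\<in>S. d x = c x) \<and> inj_on d T \<and> (\<forall>v\<in>T. d v \<notin> F v) \<longrightarrow>
      proper_on E (S \<union> T) d \<and> (\<forall>x\<in>S. conflict_free_at E (S \<union> T) d x))"
proof -
  note sym = sympD[OF E(1)] and irr = irreflpD[OF E(2)]
  have "\<forall>x\<in>S. \<exists>t. nbrs_in E S x \<noteq> {} \<longrightarrow>
      t \<in> nbrs_in E S x \<and> (\<forall>y\<in>nbrs_in E S x. c y = c t \<longrightarrow> y = t)"
    using cf unfolding conflict_free_at_def has_unique_color_def by blast
  then obtain t where t: "\<And>x. x \<in> S \<Longrightarrow> nbrs_in E S x \<noteq> {} \<Longrightarrow>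
      t x \<in> nbrs_in E S x \<and> (\<forall>y\<in>nbrs_in E S x. c y = c (t x) \<longrightarrow> y = t x)"
    by metis
  \<comment> \<open>Each old neighbor \<open>x\<close> of \<open>v\<close> contributes its own color
    and the color of its chosen witness \<open>t x\<close>.\<close>
  define F where "F v = c ` nbrs_in E S v \<union> (\<lambda>x. c (t x)) ` nbrs_in E S v" for v
  have "finite (F v)" for v using fin by (simp add: F_def)
  moreover have le: "card (F v) \<le> card (c ` nbrs_in E S v) + card (nbrs_in E S v)" for v
    unfolding F_def
    by (rule order_trans[OF card_Un_le]) (simp add: card_image_le fin)
  then have "card (F v) \<le> 2 * card (nbrs_in E S v)" for v
    using card_image_le[of "nbrs_in E S v" c] fin by (force intro: order_trans[OF le])
  moreover have "inj_on c (nbrs_in E S v)" if "card (F v) = 2 * card (nbrs_in E S v)" for v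
    using that le[of v] card_image_le[of "nbrs_in E S v" c] fin
    by (intro eq_card_imp_inj_on) auto
  moreover have "proper_on E (S \<union> T) d \<and> (\<forall>x\<in>S. conflict_free_at E (S \<union> T) d x)"
    if T: "T \<inter> S = {}" "\<forall>x\<in>S. d x = c x" "inj_on d T" "\<forall>v\<in>T. d v \<notin> F v" for T d
  proof
    have new: "d v \<noteq> d x" "d v \<noteq> c (t x)" if "v \<in> T" "x \<in> S" "E x v" for v x
      using T(2,4) that sym[OF that(3)] by (auto simp: F_def nbrs_in_def)
    show "proper_on E (S \<union> T) d"
      unfolding proper_on_def
    proof (intro ballI impI)
      fix x y assume xy: "x \<in> S \<union> T" "y \<in> S \<union> T" "E x y"
      consider "x \<in> S" "y \<in> S" | "x \<in> T" "y \<in> T" | "x \<in> S" "y \<in> T" | "x \<in> T" "y \<in> S"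
        using xy by blast
      then show "d x \<noteq> d y"
      proof cases
        case 1 with proper xy T(2) show ?thesis by (simp add: proper_on_def)
      next
        case 2 with xy irr show ?thesis using inj_onD[OF T(3)] by metis
      next
        case 3 with new xy show ?thesis by metis
      next
        case 4 with new sym xy show ?thesis by metis
      qed
    qed
    show "\<forall>x\<in>S. conflict_free_at E (S \<union> T) d x"
    proof
      fix x assume x: "x \<in> S"
      show "conflict_free_at E (S \<union> T) d x"
      proof (cases "nbrs_in E S x = {}")
        case True
        \<comment> \<open>All neighbors of \<open>x\<close> are new, and \<open>d\<close> is
          injective on them, so each one has a unique color.\<close>
        then have "nbrs_in E (S \<union> T) x \<subseteq> T" by (auto simp: nbrs_in_def)
        then show ?thesis
          unfolding conflict_free_at_def has_unique_color_def
          using inj_onD[OF T(3)] by blast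
      next
        case False
        note tx = t[OF x False]
        have "y = t x" if y: "y \<in> nbrs_in E (S \<union> T) x" "d y = d (t x)" for y
        proof -
          have "d (t x) = c (t x)" using tx T(2) by (simp add: nbrs_in_def)
          moreover from this have "y \<notin> T" using new[OF _ x] y by (auto simp: nbrs_in_def)
          ultimately show ?thesis using tx y T(2) by (auto simp: nbrs_in_def)
        qed
        moreover have "t x \<in> nbrs_in E (S \<union> T) x" using tx by (auto simp: nbrs_in_def)
        ultimately show ?thesis
          unfolding conflict_free_at_def has_unique_color_def by blast
      qed
    qed
  qed
  ultimately show ?thesis by (intro exI[of _ F]) simp
qed

lemma ex_less_not_in:
  assumes "finite P" and "card P < k"
  obtains i :: nat where "i < k" "i \<notin> P"
proof -
  have "\<not> {..<k} \<subseteq> P" using card_mono[OF assms(1), of "{..<k}"] assms(2) by auto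
  with that show ?thesis by auto
qed

text \<open>The side with two colors to spare chooses last: the color taken by the other side costs
  it at most one.\<close>

lemma ex_distinct_not_in:
  assumes fin: "finite P" "finite Q" and k: "card P < k" "card Q < k"
    and or: "Suc (card P) < k \<or> Suc (card Q) < k"
  obtains i j :: nat where "i < k" "j < k" "i \<notin> P" "j \<notin> Q" "i \<noteq> j"
  using or
proof
  assume a: "Suc (card P) < k"
  obtain j where j: "j < k" "j \<notin> Q" using ex_less_not_in fin(2) k(2) by metis
  have "card (insert j P) < k" using a card_insert_le_m1[of "Suc (card P)" P j] by simp
  then obtain i where "i < k" "i \<notin> insert j P" using ex_less_not_in fin(1) by (metis finite_insert)
  with j that show ?thesis by auto
next
  assume a: "Suc (card Q) < k"
  obtain i where i: "i < k" "i \<notin> P" using ex_less_not_in fin(1) k(1) by metis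
  have "card (insert i Q) < k" using a card_insert_le_m1[of "Suc (card Q)" Q i] by simp
  then obtain j where "j < k" "j \<notin> insert i Q" using ex_less_not_in fin(2) by (metis finite_insert)
  with i that show ?thesis by auto
qed

section \<open>Induction on the vertex set\<close>

text \<open>Since \<open>deg\<close> speaks of all nonempty subsets, it passes to smaller vertex
  sets. The palette \<open>{..<k}\<close> is fixed throughout, so a coloring of the rest can be
  extended within it.\<close>

lemma ex_pcf_coloring_of_degenerate_relation:
  fixes a b :: nat
  assumes E: "symp E" "irreflp E"
    and ab: "2 \<le> a" "a \<le> b" and k: "k = max 5 (a div 2 + 2 * b - 1)"
    and fin: "finite S"
    and deg: "\<And>R. R \<subseteq> S \<Longrightarrow> R \<noteq> {} \<Longrightarrow> (\<exists>u\<in>R. card (nbrs_in E R u) \<le> 1) \<or>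
      (\<exists>v\<in>R. \<exists>w\<in>R. E v w \<and> card (nbrs_in E R v) \<le> a \<and> card (nbrs_in E R w) \<le> b)"
  shows "\<exists>c. c ` S \<subseteq> {..<k} \<and> proper_on E S c \<and> (\<forall>x\<in>S. conflict_free_at E S c x)"
  using fin deg
proof (induction "card S" arbitrary: S rule: less_induct)
  case less
  note sym = sympD[OF E(1)] and irr = irreflpD[OF E(2)]
  have IH: "\<exists>c. c ` R \<subseteq> {..<k} \<and> proper_on E R c \<and> (\<forall>x\<in>R. conflict_free_at E R c x)"
    if R: "R \<subset> S" for R
  proof (rule less.hyps)
    show "card R < card S" using less.prems(1) R by (rule psubset_card_mono)
    show "finite R" using less.prems(1) R finite_subset by blast
  next
    fix Q assume "Q \<subseteq> R" "Q \<noteq> {}"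
    with R show "(\<exists>u\<in>Q. card (nbrs_in E Q u) \<le> 1) \<or>
        (\<exists>v\<in>Q. \<exists>w\<in>Q. E v w \<and> card (nbrs_in E Q v) \<le> a \<and> card (nbrs_in E Q w) \<le> b)"
      by (intro less.prems(2)) auto
  qed
  consider (empty) "S = {}"
    | (small) u where "u \<in> S" "card (nbrs_in E S u) \<le> 1"
    | (edge) v w where "v \<in> S" "w \<in> S" "E v w"
        "card (nbrs_in E S v) \<le> a" "card (nbrs_in E S w) \<le> b"
    using less.prems(2)[of S] by blast
  then show ?case
  proof cases
    case empty
    then show ?thesis by (auto simp: proper_on_def)
  next
    case small
    define R where "R = S - {u}"
    have finR: "finite R" using less.prems(1) by (simp add: R_def)
    obtain c where c: "c ` R \<subseteq> {..<k}" "proper_on E R c" "\<forall>x\<in>R. conflict_free_at E R c x"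
      using IH[of R] small(1) by (auto simp: R_def)
    obtain F where F: "\<forall>v. finite (F v) \<and> card (F v) \<le> 2 * card (nbrs_in E R v) \<and>
        (card (F v) = 2 * card (nbrs_in E R v) \<longrightarrow> inj_on c (nbrs_in E R v))"
      and ext: "\<forall>T d. T \<inter> R = {} \<and> (\<forall>x\<in>R. d x = c x) \<and> inj_on d T \<and> (\<forall>v\<in>T. d v \<notin> F v) \<longrightarrow>
        proper_on E (R \<union> T) d \<and> (\<forall>x\<in>R. conflict_free_at E (R \<union> T) d x)"
      using ex_forbidden_colors[OF E finR c(2,3)] by (elim exE conjE)
    have Nu: "nbrs_in E R u = nbrs_in E S u" using irr by (auto simp: nbrs_in_def R_def)
    have "card (F u) \<le> 2 * card (nbrs_in E S u)" using F Nu by metis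
    \<comment> \<open>At most two colors are forbidden at \<open>u\<close>, and \<open>k\<close> is
      at least 5.\<close>
    then have "card (F u) < k" using small(2) k by linarith
    then obtain i where i: "i < k" "i \<notin> F u" using ex_less_not_in F by metis
    define d where "d = c(u := i)"
    have S: "S = R \<union> {u}" using small(1) by (auto simp: R_def)
    have "proper_on E S d \<and> (\<forall>x\<in>R. conflict_free_at E S d x)"
      unfolding S using i(2) by (intro ext[rule_format] conjI) (auto simp: d_def R_def)
    moreover have "conflict_free_at E S d u"
      unfolding conflict_free_at_def has_unique_color_def
      using small(2) less.prems(1) by (metis One_nat_def card_le_Suc0_iff_eq ex_in_conv finite_nbrs_in)
    moreover have "d ` S \<subseteq> {..<k}" using c(1) i(1) by (auto simp: d_def R_def)
    ultimately show ?thesis using S by blast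
  next
    case edge
    have vw: "v \<noteq> w" using edge(3) irr by metis
    define R where "R = S - {v, w}"
    have finR: "finite R" using less.prems(1) by (simp add: R_def)
    obtain c where c: "c ` R \<subseteq> {..<k}" "proper_on E R c" "\<forall>x\<in>R. conflict_free_at E R c x"
      using IH[of R] edge(1) by (auto simp: R_def)
    obtain F where F: "\<forall>v. finite (F v) \<and> card (F v) \<le> 2 * card (nbrs_in E R v) \<and>
        (card (F v) = 2 * card (nbrs_in E R v) \<longrightarrow> inj_on c (nbrs_in E R v))"
      and ext: "\<forall>T d. T \<inter> R = {} \<and> (\<forall>x\<in>R. d x = c x) \<and> inj_on d T \<and> (\<forall>v\<in>T. d v \<notin> F v) \<longrightarrow>
        proper_on E (R \<union> T) d \<and> (\<forall>x\<in>R. conflict_free_at E (R \<union> T) d x)"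
      using ex_forbidden_colors[OF E finR c(2,3)] by (elim exE conjE)
    define A B where "A = nbrs_in E R v" and "B = nbrs_in E R w"
    have fAB: "finite A" "finite B" using finR by (auto simp: A_def B_def)
    have wA: "w \<notin> A" and vB: "v \<notin> B" by (auto simp: A_def B_def nbrs_in_def R_def)
    have Nv: "nbrs_in E S v = insert w A" and Nw: "nbrs_in E S w = insert v B"
      using edge sym irr by (auto simp: A_def B_def nbrs_in_def R_def)
    have cA: "card A \<le> a - 1" and cB: "card B \<le> b - 1"
      using edge(4,5) Nv Nw wA vB fAB by auto
    obtain X where X: "finite X" "card X \<le> max 1 (card A div 2)"
        "inj_on c A \<and> 2 \<le> card A \<longrightarrow> X = {}"
        "\<forall>d. (\<forall>x\<in>A. d x = c x) \<and> d w \<notin> X \<longrightarrow> has_unique_color d (insert w A)"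
      using ex_avoid_set_has_unique_color_insert[OF fAB(1) wA, of c] by (elim exE conjE)
    obtain Y where Y: "finite Y" "card Y \<le> max 1 (card B div 2)"
        "\<forall>d. (\<forall>x\<in>B. d x = c x) \<and> d v \<notin> Y \<longrightarrow> has_unique_color d (insert v B)"
      using ex_avoid_set_has_unique_color_insert[OF fAB(2) vB, of c] by (elim exE conjE)
    \<comment> \<open>The roles cross over: \<open>X\<close> secures a unique color around
      \<open>v\<close> but restricts the color of \<open>w\<close>, and \<open>Y\<close> does the
      reverse.\<close>
    have P: "card (F v \<union> Y) \<le> card (F v) + card Y" and Q: "card (F w \<union> X) \<le> card (F w) + card X"
      by (rule card_Un_le)+
    have Fv: "card (F v) \<le> 2 * card A" and Fw: "card (F w) \<le> 2 * card B"
      using F by (auto simp: A_def B_def)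
    have "card A div 2 \<le> (a - 1) div 2" "card B div 2 \<le> (b - 1) div 2"
      using cA cB by (auto intro: div_le_mono)
    then have cX: "card X \<le> max 1 ((a - 1) div 2)" and cY: "card Y \<le> max 1 ((b - 1) div 2)"
      using X(2) Y(2) by linarith+
    have Pk: "card (F v \<union> Y) < k"
      using P Fv cA cY ab k by linarith
    \<comment> \<open>This is where the shape of the bound comes from: at most
      \<open>2 * (b - 1)\<close> colors from \<open>F w\<close>, at most \<open>a div 2\<close> from
      \<open>X\<close>, and one more color to use.\<close>
    have Qk: "card (F w \<union> X) < k"
      using Q Fw cB cX ab k by linarith
    have "Suc (card (F v \<union> Y)) < k \<or> Suc (card (F w \<union> X)) < k"
    proof -
      consider "inj_on c A" "2 \<le> card A" | "card A \<le> 1" | "\<not> inj_on c A" by linarith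
      then show ?thesis
      proof cases
        case 1
        then have X0: "card X = 0" using X(3) by simp
        \<comment> \<open>With \<open>X\<close> empty, \<open>w\<close> gains the
          \<open>a div 2\<close> colors reserved for it, which is at least one.\<close>
        have "Suc (card (F w \<union> X)) < k"
          using Q Fw cB X0 ab k by linarith
        then show ?thesis ..
      next
        case 2
        \<comment> \<open>Now \<open>F v\<close> has at most two colors. For
          \<open>a = b = 2\<close> the left side can only be bounded by 4, while
          \<open>a div 2 + 2 * b - 1\<close> is also 4; the constant 5 covers this case.\<close>
        have "Suc (card (F v \<union> Y)) < k"
          using P Fv 2 cY ab k by linarith
        then show ?thesis ..
      next
        case 3
        then have "card (F v) \<noteq> 2 * card A" using F by (auto simp: A_def)
        then have lt: "card (F v) < 2 * card A" using Fv by simp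
        \<comment> \<open>The color saved by the repetition in \<open>A\<close> offsets the
          \<open>Suc\<close>, leaving the same estimate as for \<open>Pk\<close>.\<close>
        have "Suc (card (F v \<union> Y)) < k"
          using P lt cA cY ab k by linarith
        then show ?thesis ..
      qed
    qed
    then obtain i j where ij: "i < k" "j < k" "i \<notin> F v \<union> Y" "j \<notin> F w \<union> X" "i \<noteq> j"
      using ex_distinct_not_in[OF _ _ Pk Qk] F X(1) Y(1) by (metis finite_Un)
    define d where "d = c(v := i, w := j)"
    have dR: "\<forall>x\<in>R. d x = c x" by (simp add: d_def R_def)
    have dA: "\<forall>x\<in>A. d x = c x" and dB: "\<forall>x\<in>B. d x = c x"
      using dR by (auto simp: A_def B_def nbrs_in_def)
    have d: "d v = i" "d w = j" using vw by (auto simp: d_def)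
    have S: "S = R \<union> {v, w}" using edge(1,2) by (auto simp: R_def)
    \<comment> \<open>The extension property is applied with \<open>{v, w}\<close> as the new
      vertices; \<open>i \<noteq> j\<close> gives injectivity on them.\<close>
    have "proper_on E S d \<and> (\<forall>x\<in>R. conflict_free_at E S d x)"
      unfolding S using ij dR d by (intro ext[rule_format] conjI) (auto simp: R_def)
    moreover have "conflict_free_at E S d v"
      unfolding conflict_free_at_def Nv using X(4)[rule_format, of d] dA d ij by simp
    moreover have "conflict_free_at E S d w"
      unfolding conflict_free_at_def Nw using Y(3)[rule_format, of d] dB d ij by simp
    moreover have "d ` S \<subseteq> {..<k}" using c(1) ij d dR unfolding S by auto
    ultimately show ?thesis using S by blast
  qed
qed

section \<open>Transfer to digraphs\<close>

text \<open>Without parallel arcs, an arc leaving \<open>u\<close> is determined by its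
  head.\<close>

lemma (in nomulti_digraph) out_degree_eq_card_adj:
  "out_degree G u = card {y. u \<rightarrow> y}"
proof -
  have "inj_on (head G) (out_arcs G u)"
    by (auto simp: inj_on_def arc_to_ends_def intro: no_multi_arcs)
  moreover have "head G ` out_arcs G u = {y. u \<rightarrow> y}"
    by (force simp: arcs_ends_def arc_to_ends_def)
  ultimately show ?thesis unfolding out_degree_def by (metis card_image)
qed

text \<open>Every nonempty \<open>R\<close> is the vertex set of an induced subgraph, whose
  out-degrees count the neighbors inside \<open>R\<close>. This supplies the hypothesis
  \<open>deg\<close> of the induction.\<close>

lemma (in graph) degenerate_nbrs_in:
  assumes "degenerate a b G" and R: "R \<subseteq> verts G" "R \<noteq> {}"
  shows "(\<exists>u\<in>R. card (nbrs_in (dominates G) R u) \<le> 1) \<or>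
      (\<exists>v\<in>R. \<exists>w\<in>R. v \<rightarrow> w \<and> card (nbrs_in (dominates G) R v) \<le> a \<and>
        card (nbrs_in (dominates G) R w) \<le> b)"
proof -
  let ?H = "G \<restriction> R"
  have ind: "induced_subgraph ?H G" using R(1) by (rule induced_induce)
  interpret H: digraph ?H using ind by (rule digraphI_induced)
  have adj: "x \<rightarrow>\<^bsub>?H\<^esub> y \<longleftrightarrow> x \<in> R \<and> y \<in> R \<and> x \<rightarrow> y" for x y
    by (auto simp: arcs_ends_def arc_to_ends_def induce_subgraph_def)
  have out: "out_degree ?H u = card (nbrs_in (dominates G) R u)" if "u \<in> R" for u
  proof -
    have "{y. u \<rightarrow>\<^bsub>?H\<^esub> y} = nbrs_in (dominates G) R u"
      using adj that by (auto simp only: nbrs_in_def)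
    then show ?thesis by (simp only: H.out_degree_eq_card_adj)
  qed
  have "verts ?H = R" by simp
  then have "(\<exists>u\<in>R. out_degree ?H u \<le> 1) \<or>
      (\<exists>v w. v \<rightarrow>\<^bsub>?H\<^esub> w \<and> out_degree ?H v \<le> a \<and> out_degree ?H w \<le> b)"
    using assms(1) ind R(2) unfolding degenerate_def by metis
  then show ?thesis using adj out by (metis (no_types, lifting))
qed

theorem theorem4p1:
  fixes G :: "('a, 'b) pre_digraph" and a b :: nat
  assumes "2 \<le> a" and "a \<le> b"
    and "graph G"
    and "degenerate a b G"
  shows "pcf_chromatic_number G \<le> max 5 (a div 2 + 2 * b - 1)"
proof -
  interpret graph G by fact
  let ?E = "dominates G"
  define k where "k = max 5 (a div 2 + 2 * b - 1)"
  have "symp ?E" "irreflp ?E"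
    using graph_symmetric adj_not_same by (auto simp: symp_def irreflp_def)
  then obtain c where c: "c ` verts G \<subseteq> {..<k}" "proper_on ?E (verts G) c"
      "\<forall>x\<in>verts G. conflict_free_at ?E (verts G) c x"
    using ex_pcf_coloring_of_degenerate_relation[of ?E a b k "verts G"]
      degenerate_nbrs_in[OF assms(4)] assms(1,2) k_def by auto
  \<comment> \<open>Arcs end in vertices of \<open>G\<close>, so restricting to
    \<open>verts G\<close> loses no neighbor.\<close>
  have nbhd: "nbrs_in ?E (verts G) x = nbhd G x" for x
    by (auto simp: nbrs_in_def nbhd_def)
  have "card (c ` verts G) \<le> k" using card_mono[OF _ c(1)] by simp
  moreover have "proper_coloring G c"
    using c(2) unfolding proper_on_def proper_coloring_def by (meson adj_in_verts)
  moreover have "conflict_free_coloring G c"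
    using c(3) unfolding conflict_free_at_def conflict_free_coloring_def nbhd
    by (simp add: has_unique_color_iff_card)
  ultimately have "pcf_coloring G k c" by (simp add: pcf_coloring_def)
  then show ?thesis unfolding pcf_chromatic_number_def k_def[symmetric] by (blast intro: Least_le)
qed

end
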